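(* Let $\mathcal G$ and $\mathcal H$ be graphs. The following are equivalent: (i) The skeletons $\mathcal G^\circ$ and $\mathcal H^\circ$ are isomorphic. (ii) $\mathcal G$ and $\mathcal H$ are full pullbacks of isomorphic graphs; that is, there are isomorphic graphs $\mathcal K$ and $\mathcal F$ such that $\mathcal G$ is a full pullback of $\mathcal K$ and $\mathcal H$ is a full pullback of $\mathcal F$.
   Context: All graphs are finite, simple and undirected. Write $x\simeq_{\mathcal G}y$ if $x=y$ or $x$ is adjacent to $y$ in $\mathcal G$. Vertices $x,y$ of $\mathcal G$ are true twins if $\{z: x\simeq_{\mathcal G}z\}=\{z: y\simeq_{\mathcal G}z\}$; this is an equivalence relation, with class of $x$ denoted $[x]$. The skeleton $\mathcal G^\circ$ is the graph whose vertices are the true-twin equivalence classes of $\mathcal G$, where distinct classes $[x],[y]$ are adjacent whenever $x$ is adjacent to $y$ in $\mathcal G$ (this is well defined). $\mathcal G$ is a pullback of $\mathcal K$ if there is a map $f\colon V(\mathcal G)\to V(\mathcal K)$ such that $x\simeq_{\mathcal G}y\iff f(x)\simeq_{\mathcal K}f(y)$ for all $x,y\in V(\mathcal G)$; it is a full pullback of $\mathcal K$ if such an $f$ can be chosen surjective. *)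

theory Defs
  imports "Graph_Theory.Pair_Digraph" "Graph_Theory.Digraph_Isomorphism"
    "HOL-Library.Infinite_Typeclass" "HOL-Library.FuncSet"
begin

text \<open>
  A finite simple undirected graph is a \<open>pair_graph\<close> of the AFP entry Graph_Theory: a finite,
  loop-free, symmetric set of arcs, an edge being represented by its two arcs. Vertex sets may be
  empty. Graph isomorphism is \<open>digraph_iso\<close>, applied after \<open>with_proj\<close>; the endpoints of an arc
  are its two components, so an isomorphism is a bijection of the vertices that preserves and
  reflects adjacency.
\<close>

definition adj_eq :: "'a pair_pre_digraph \<Rightarrow> 'a \<Rightarrow> 'a \<Rightarrow> bool" where
  "adj_eq G x y \<longleftrightarrow> x = y \<or> (x, y) \<in> parcs G"

definition twin_rel :: "'a pair_pre_digraph \<Rightarrow> 'a rel" where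
  "twin_rel G = {(x, y). x \<in> pverts G \<and> y \<in> pverts G \<and>
     {z \<in> pverts G. adj_eq G x z} = {z \<in> pverts G. adj_eq G y z}}"

definition twin_class :: "'a pair_pre_digraph \<Rightarrow> 'a \<Rightarrow> 'a set" where
  "twin_class G x = twin_rel G `` {x}"

definition skeleton :: "'a pair_pre_digraph \<Rightarrow> 'a set pair_pre_digraph" where
  "skeleton G = \<lparr> pverts = pverts G // twin_rel G,
     parcs = {(twin_class G x, twin_class G y) | x y.
       (x, y) \<in> parcs G \<and> twin_class G x \<noteq> twin_class G y} \<rparr>"

definition pullback_map :: "'a pair_pre_digraph \<Rightarrow> 'b pair_pre_digraph \<Rightarrow> ('a \<Rightarrow> 'b) \<Rightarrow> bool" where
  "pullback_map G K f \<longleftrightarrow> f \<in> pverts G \<rightarrow> pverts K \<and>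
     (\<forall>x \<in> pverts G. \<forall>y \<in> pverts G. adj_eq G x y \<longleftrightarrow> adj_eq K (f x) (f y))"

definition full_pullback :: "'a pair_pre_digraph \<Rightarrow> 'b pair_pre_digraph \<Rightarrow> bool" where
  "full_pullback G K \<longleftrightarrow> (\<exists>f. pullback_map G K f \<and> f ` pverts G = pverts K)"

lemma equiv_twin_rel: "equiv (pverts G) (twin_rel G)"
  unfolding equiv_def refl_on_def sym_def trans_def twin_rel_def by auto

text \<open>Adjacency in the skeleton does not depend on the representatives.\<close>

lemma (in pair_graph) skeleton_adj_iff:
  assumes "x \<in> pverts G" "y \<in> pverts G" "twin_class G x \<noteq> twin_class G y"
  shows "(twin_class G x, twin_class G y) \<in> parcs (skeleton G) \<longleftrightarrow> (x, y) \<in> parcs G"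
proof
  assume "(twin_class G x, twin_class G y) \<in> parcs (skeleton G)"
  then obtain u v where uv: "(u, v) \<in> parcs G"
    and cl: "twin_class G x = twin_class G u" "twin_class G y = twin_class G v"
    by (auto simp: skeleton_def)
  have mem: "u \<in> pverts G" "v \<in> pverts G" using uv in_arcsD1 in_arcsD2 by auto
  have xu: "(x, u) \<in> twin_rel G" and yv: "(y, v) \<in> twin_rel G"
    using cl assms mem equiv_twin_rel[of G]
    by (auto simp: twin_class_def eq_equiv_class_iff)
  have "adj_eq G u v" using uv by (simp add: adj_eq_def)
  hence "adj_eq G x v" using xu mem by (auto simp: twin_rel_def)
  hence "adj_eq G v x"
    using pair_sym_arcs unfolding adj_eq_def symmetric_def sym_def by auto
  hence "adj_eq G y x" using yv assms by (auto simp: twin_rel_def)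
  hence "(y, x) \<in> parcs G" using assms by (auto simp: adj_eq_def)
  thus "(x, y) \<in> parcs G"
    using pair_sym_arcs unfolding symmetric_def sym_def by auto
next
  assume "(x, y) \<in> parcs G"
  thus "(twin_class G x, twin_class G y) \<in> parcs (skeleton G)"
    using assms by (auto simp: skeleton_def)
qed

lemma (in pair_graph) pair_graph_skeleton: "pair_graph (skeleton G)"
proof -
  have sub: "parcs (skeleton G) \<subseteq> pverts (skeleton G) \<times> pverts (skeleton G)"
    by (auto simp: skeleton_def twin_class_def intro!: quotientI dest: in_arcsD1 in_arcsD2)
  have fin: "finite (pverts (skeleton G))"
    using pair_finite_verts by (simp add: skeleton_def quotient_def)
  have "symmetric (with_proj (skeleton G))"
    unfolding symmetric_def with_proj_simps
  proof (rule symI)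
    fix A B assume "(A, B) \<in> parcs (skeleton G)"
    then obtain x y where "A = twin_class G x" "B = twin_class G y" "(y, x) \<in> parcs G" "A \<noteq> B"
      using pair_sym_arcs by (auto simp: skeleton_def symmetric_def dest: symD)
    thus "(B, A) \<in> parcs (skeleton G)" unfolding skeleton_def by auto
  qed
  moreover have "A \<noteq> B" if "(A, B) \<in> parcs (skeleton G)" for A B
    using that unfolding skeleton_def by auto
  moreover have "finite (parcs (skeleton G))" using finite_subset[OF sub] fin by simp
  ultimately show ?thesis
    using sub fin by unfold_locales auto
qed

text \<open>
  In the theorem the auxiliary graphs have their vertices in arbitrary infinite types, so that
  every finite graph occurs there up to isomorphism.
\<close>

end

theory Submission
  imports Defs
begin

text \<open>
  The map sending a vertex to its twin class is a full pullback of \<open>G\<close> onto its skeleton. A full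
  pullback \<open>f\<close> of \<open>G\<close> onto \<open>K\<close> preserves and reflects the twin relation, and because it is
  surjective it sends the class of \<open>x\<close> onto the class of \<open>f x\<close>; so \<open>A \<mapsto> f ` A\<close> is an isomorphism of
  the skeletons. An isomorphism of graphs is itself a bijective full pullback, so isomorphic
  graphs have isomorphic skeletons too.
\<close>

section \<open>Isomorphisms as bijective pullback maps, and composition of full pullbacks\<close>

lemma (in pair_graph) no_loop: "(x, x) \<notin> parcs G"
  using no_loops by force

text \<open>Injectivity of \<open>f\<close> keeps distinct vertices distinct, and between distinct
  vertices \<open>adj_eq\<close> is plain adjacency. Pairs of equal vertices are settled by the
  absence of loops in both graphs.\<close>

lemma digraph_iso_with_projI:
  assumes "pair_graph G" "pair_graph H" "pullback_map G H f" "bij_betw f (pverts G) (pverts H)"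
  shows "digraph_iso (with_proj G) (with_proj H)"
proof -
  interpret G: pair_graph G by fact
  interpret H: pair_graph H by fact
  have inj: "inj_on f (pverts G)" and img: "f ` pverts G = pverts H"
    using assms(4) by (auto simp: bij_betw_def)
  have arc: "(x, y) \<in> parcs G \<longleftrightarrow> (f x, f y) \<in> parcs H"
    if "x \<in> pverts G" "y \<in> pverts G" for x y
  proof (cases "x = y")
    case False
    hence "f x \<noteq> f y" using inj that by (auto dest: inj_onD)
    thus ?thesis using False assms(3) that by (auto simp: pullback_map_def adj_eq_def)
  qed (simp add: G.no_loop H.no_loop)
  \<comment> \<open>An isomorphism record also carries an arc map and the endpoint maps of the
    target. Arcs are pairs, so \<open>f\<close> acts on them componentwise, and the endpoints remain
    the two projections.\<close>
  define h where "h = \<lparr>iso_verts = f, iso_arcs = map_prod f f, iso_head = snd, iso_tail = fst\<rparr>"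
  have "inj_on (map_prod f f) (pverts G \<times> pverts G)"
    using inj by (auto intro: map_prod_inj_on)
  hence "inj_on (map_prod f f) (parcs G)"
    by (rule inj_on_subset) (auto dest: G.in_arcsD1 G.in_arcsD2)
  hence "G.digraph_isomorphism h"
    using inj G.wf_digraph by (auto simp: G.digraph_isomorphism_def h_def)
  moreover have "map_prod f f ` parcs G = parcs H"
  proof (intro equalityI subsetI)
    fix b assume b: "b \<in> parcs H"
    then obtain x y where "x \<in> pverts G" "y \<in> pverts G" "b = (f x, f y)"
      using img H.in_arcsD1 H.in_arcsD2 by (metis imageE surj_pair)
    with b arc show "b \<in> map_prod f f ` parcs G" by force
  next
    fix b assume "b \<in> map_prod f f ` parcs G"
    then obtain x y where xy: "(x, y) \<in> parcs G" "b = (f x, f y)" by auto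
    hence "x \<in> pverts G" "y \<in> pverts G" using G.in_arcsD1 G.in_arcsD2 by auto
    with xy arc show "b \<in> parcs H" by simp
  qed
  hence "with_proj H = app_iso h (with_proj G)"
    using img by (simp add: app_iso_def with_proj_def h_def)
  ultimately show ?thesis unfolding digraph_iso_def by blast
qed

lemma digraph_iso_with_projE:
  assumes "digraph_iso (with_proj G) (with_proj H)"
  obtains f where "pullback_map G H f" "bij_betw f (pverts G) (pverts H)"
proof -
  obtain h where iso: "pre_digraph.digraph_isomorphism (with_proj G) h"
    and H: "with_proj H = app_iso h (with_proj G)"
    using assms unfolding digraph_iso_def by blast
  define f where "f = iso_verts h"
  \<comment> \<open>Since the image graph is of the form \<open>with_proj H\<close>, the endpoint
    maps in \<open>h\<close> must be the projections. This forces the arc map to be \<open>f\<close>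
    on both components, so the vertex map determines everything.\<close>
  have verts: "pverts H = f ` pverts G" and arcs: "parcs H = iso_arcs h ` parcs G"
    and proj: "iso_tail h = fst" "iso_head h = snd"
    using H by (simp_all add: app_iso_def with_proj_def f_def)
  have wf: "wf_digraph (with_proj G)" and inj: "inj_on f (pverts G)"
    and ends: "\<And>a. a \<in> parcs G \<Longrightarrow> iso_arcs h a = (f (fst a), f (snd a))"
    using iso proj by (auto simp: pre_digraph.digraph_isomorphism_def f_def prod_eq_iff)
  interpret G: pair_wf_digraph G using wf by (simp add: wf_digraph_wp_iff)
  have "(x, y) \<in> parcs G \<longleftrightarrow> (f x, f y) \<in> parcs H"
    if xy: "x \<in> pverts G" "y \<in> pverts G" for x y
  proof
    assume "(f x, f y) \<in> parcs H"
    then obtain u v where uv: "(u, v) \<in> parcs G" "f u = f x" "f v = f y"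
      using arcs ends by force
    moreover have "u \<in> pverts G" "v \<in> pverts G" using uv G.in_arcsD1 G.in_arcsD2 by auto
    ultimately show "(x, y) \<in> parcs G" using xy inj by (metis inj_onD)
  qed (use arcs ends in force)
  moreover have "x = y \<longleftrightarrow> f x = f y" if "x \<in> pverts G" "y \<in> pverts G" for x y
    using inj that by (auto dest: inj_onD)
  ultimately have "pullback_map G H f"
    unfolding pullback_map_def adj_eq_def using verts by blast
  moreover have "bij_betw f (pverts G) (pverts H)"
    using inj verts by (simp add: bij_betw_def)
  ultimately show thesis by (rule that)
qed

lemma full_pullback_trans:
  assumes "full_pullback G K" "full_pullback K L"
  shows "full_pullback G L"
proof -
  obtain f g where "pullback_map G K f" "f ` pverts G = pverts K"
    "pullback_map K L g" "g ` pverts K = pverts L"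
    using assms unfolding full_pullback_def by blast
  hence "pullback_map G L (g \<circ> f) \<and> (g \<circ> f) ` pverts G = pverts L"
    unfolding image_comp[symmetric] by (auto simp: pullback_map_def Pi_iff)
  thus ?thesis unfolding full_pullback_def by blast
qed

lemma digraph_iso_imp_full_pullback:
  "digraph_iso (with_proj G) (with_proj H) \<Longrightarrow> full_pullback G H"
  by (auto elim!: digraph_iso_with_projE simp: full_pullback_def bij_betw_def)

section \<open>Twin classes and skeletons under full pullbacks\<close>

lemma twin_class_eq_iff:
  assumes "x \<in> pverts G" "y \<in> pverts G"
  shows "twin_class G x = twin_class G y \<longleftrightarrow> (x, y) \<in> twin_rel G"
  using eq_equiv_class_iff[OF equiv_twin_rel assms] by (simp add: twin_class_def)

lemma pverts_skeleton: "pverts (skeleton G) = twin_class G ` pverts G"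
  by (auto simp: skeleton_def quotient_def twin_class_def)

text \<open>True twins are equal or adjacent, because the closed neighbourhood of \<open>y\<close>
  contains \<open>y\<close> itself. Collapsing a class to one vertex therefore agrees with the
  reflexivity of \<open>adj_eq\<close>; between distinct classes adjacency is independent of
  representatives.\<close>

lemma (in pair_graph) pullback_map_twin_class: "pullback_map G (skeleton G) (twin_class G)"
  unfolding pullback_map_def
proof (intro conjI ballI)
  fix x y assume xy: "x \<in> pverts G" "y \<in> pverts G"
  show "adj_eq G x y \<longleftrightarrow> adj_eq (skeleton G) (twin_class G x) (twin_class G y)"
  proof (cases "twin_class G x = twin_class G y")
    case True
    hence "(x, y) \<in> twin_rel G" using xy twin_class_eq_iff by metis
    hence "adj_eq G x y \<longleftrightarrow> adj_eq G y y" using xy by (auto simp: twin_rel_def)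
    with True show ?thesis by (simp add: adj_eq_def)
  next
    case False
    with skeleton_adj_iff[OF xy] show ?thesis by (auto simp: adj_eq_def)
  qed
qed (auto simp: pverts_skeleton)

lemma (in pair_graph) full_pullback_skeleton: "full_pullback G (skeleton G)"
  using pullback_map_twin_class unfolding full_pullback_def by (metis pverts_skeleton)

text \<open>Surjectivity is what makes twins of \<open>G\<close> remain twins in \<open>K\<close>: a
  vertex of \<open>K\<close> outside the image could tell \<open>f x\<close> and \<open>f y\<close>
  apart.\<close>

lemma twin_rel_pullback_iff:
  assumes "pullback_map G K f" "f ` pverts G = pverts K" "x \<in> pverts G" "y \<in> pverts G"
  shows "(f x, f y) \<in> twin_rel K \<longleftrightarrow> (x, y) \<in> twin_rel G"
proof -
  have "(x, y) \<in> twin_rel G \<longleftrightarrow> (\<forall>z \<in> pverts G. adj_eq G x z \<longleftrightarrow> adj_eq G y z)"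
    using assms by (auto simp: twin_rel_def)
  also have "\<dots> \<longleftrightarrow> (\<forall>z \<in> pverts G. adj_eq K (f x) (f z) \<longleftrightarrow> adj_eq K (f y) (f z))"
    using assms by (simp add: pullback_map_def)
  also have "\<dots> \<longleftrightarrow> (\<forall>z \<in> pverts K. adj_eq K (f x) z \<longleftrightarrow> adj_eq K (f y) z)"
    unfolding assms(2)[symmetric] by simp
  also have "\<dots> \<longleftrightarrow> (f x, f y) \<in> twin_rel K"
    using assms(2-4) by (auto simp: twin_rel_def)
  finally show ?thesis by simp
qed

text \<open>One inclusion holds because \<open>f\<close> preserves twins. For the other, a twin of
  \<open>f x\<close> is lifted by surjectivity, and the lift is a twin of \<open>x\<close> because
  \<open>f\<close> reflects twins.\<close>

lemma image_twin_class:
  assumes f: "pullback_map G K f" "f ` pverts G = pverts K" and x: "x \<in> pverts G"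
  shows "f ` twin_class G x = twin_class K (f x)"
proof (intro equalityI subsetI)
  fix z assume "z \<in> f ` twin_class G x"
  then obtain y where "z = f y" "(x, y) \<in> twin_rel G" by (auto simp: twin_class_def)
  moreover have "y \<in> pverts G" using calculation by (simp add: twin_rel_def)
  ultimately show "z \<in> twin_class K (f x)"
    using twin_rel_pullback_iff[OF f x] by (simp add: twin_class_def)
next
  fix z assume z: "z \<in> twin_class K (f x)"
  hence "z \<in> pverts K" by (simp add: twin_class_def twin_rel_def)
  then obtain y where "y \<in> pverts G" "z = f y" using f(2) by blast
  with z show "z \<in> f ` twin_class G x"
    using twin_rel_pullback_iff[OF f x] by (auto simp: twin_class_def)
qed

text \<open>Injectivity of the map on classes comes from reflection of twins. Adjacency is carried
  through representatives: down from \<open>skeleton G\<close> to \<open>G\<close>, along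
  \<open>f\<close> to \<open>K\<close>, and up to \<open>skeleton K\<close>.\<close>

lemma full_pullback_imp_skeleton_iso:
  assumes "pair_graph G" "pair_graph K" "full_pullback G K"
  shows "digraph_iso (with_proj (skeleton G)) (with_proj (skeleton K))"
proof -
  interpret G: pair_graph G by fact
  interpret K: pair_graph K by fact
  obtain f where f: "pullback_map G K f" "f ` pverts G = pverts K"
    using assms(3) unfolding full_pullback_def by blast
  have img: "(`) f ` pverts (skeleton G) = pverts (skeleton K)"
    unfolding pverts_skeleton f(2)[symmetric] image_image
    by (intro image_cong refl image_twin_class[OF f])
  have "inj_on ((`) f) (pverts (skeleton G))"
  proof (rule inj_onI)
    fix A B assume A: "A \<in> pverts (skeleton G)" "B \<in> pverts (skeleton G)" and eq: "f ` A = f ` B"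
    then obtain x y where xy: "x \<in> pverts G" "y \<in> pverts G"
      and AB: "A = twin_class G x" "B = twin_class G y"
      by (auto simp: pverts_skeleton)
    have "f x \<in> pverts K" "f y \<in> pverts K" using f(2) xy by auto
    moreover have "twin_class K (f x) = twin_class K (f y)"
      using eq AB xy by (simp add: image_twin_class[OF f])
    ultimately have "(x, y) \<in> twin_rel G"
      using xy by (simp add: twin_class_eq_iff twin_rel_pullback_iff[OF f])
    thus "A = B" using AB xy by (simp add: twin_class_eq_iff)
  qed
  moreover have "adj_eq (skeleton G) A B \<longleftrightarrow> adj_eq (skeleton K) (f ` A) (f ` B)"
    if AB: "A \<in> pverts (skeleton G)" "B \<in> pverts (skeleton G)" for A B
  proof -
    obtain x y where xy: "x \<in> pverts G" "y \<in> pverts G"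
      and AB: "A = twin_class G x" "B = twin_class G y"
      using AB by (auto simp: pverts_skeleton)
    have fxy: "f x \<in> pverts K" "f y \<in> pverts K" using f(2) xy by auto
    have "adj_eq (skeleton G) A B \<longleftrightarrow> adj_eq G x y"
      using G.pullback_map_twin_class xy AB by (simp add: pullback_map_def)
    also have "\<dots> \<longleftrightarrow> adj_eq K (f x) (f y)" using f(1) xy by (simp add: pullback_map_def)
    also have "\<dots> \<longleftrightarrow> adj_eq (skeleton K) (twin_class K (f x)) (twin_class K (f y))"
      using K.pullback_map_twin_class fxy by (simp add: pullback_map_def)
    finally show ?thesis using xy AB by (simp add: image_twin_class[OF f])
  qed
  ultimately show ?thesis
    using img G.pair_graph_skeleton K.pair_graph_skeleton
    by (intro digraph_iso_with_projI[where f = "(`) f"])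
       (auto simp: pullback_map_def bij_betw_def)
qed

section \<open>Copies of finite graphs in infinite types, and the equivalence\<close>

lemma (in pair_graph) iso_copy_in_infinite_type:
  obtains K :: "'k::infinite pair_pre_digraph"
  where "pair_graph K" "digraph_iso (with_proj G) (with_proj K)"
proof -
  \<comment> \<open>An infinite type has finite subsets of every cardinality; one of the size of
    \<open>pverts G\<close> receives the graph structure along a bijection \<open>e\<close>.\<close>
  obtain B :: "'k set" where B: "finite B" "card B = card (pverts G)"
    using infinite_arbitrarily_large[OF infinite_UNIV] by blast
  then obtain e where e: "bij_betw e (pverts G) B"
    using pair_finite_verts finite_same_card_bij by metis
  define K where "K = \<lparr>pverts = B, parcs = map_prod e e ` parcs G\<rparr>"
  have img: "e ` pverts G = B" and inj: "inj_on e (pverts G)"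
    using e by (auto simp: bij_betw_def)
  have eq_iff: "e x = e y \<longleftrightarrow> x = y" if "x \<in> pverts G" "y \<in> pverts G" for x y
    using inj that by (auto dest: inj_onD)
  have arc: "(e x, e y) \<in> parcs K \<longleftrightarrow> (x, y) \<in> parcs G" if "x \<in> pverts G" "y \<in> pverts G" for x y
    using that eq_iff in_arcsD1 in_arcsD2 by (fastforce simp: K_def)
  have sym: "(b, a) \<in> parcs K" if ab: "(a, b) \<in> parcs K" for a b
  proof -
    obtain x y where "(x, y) \<in> parcs G" "a = e x" "b = e y" using ab by (auto simp: K_def)
    moreover have "(y, x) \<in> parcs G"
      using pair_sym_arcs calculation(1) by (auto simp: symmetric_def dest: symD)
    ultimately show ?thesis by (force simp: K_def)
  qed
  have sub: "parcs K \<subseteq> pverts K \<times> pverts K"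
    using img in_arcsD1 in_arcsD2 by (auto simp: K_def)
  have irrefl: "a \<noteq> b" if ab: "(a, b) \<in> parcs K" for a b
  proof -
    obtain x y where xy: "(x, y) \<in> parcs G" "a = e x" "b = e y" using ab by (auto simp: K_def)
    hence "x \<noteq> y" "x \<in> pverts G" "y \<in> pverts G" using no_loop in_arcsD1 in_arcsD2 by auto
    thus ?thesis using xy eq_iff by simp
  qed
  have "finite (pverts K)" "finite (parcs K)"
    using B(1) pair_finite_arcs by (simp_all add: K_def)
  moreover have "symmetric (with_proj K)"
    using sym by (auto simp: symmetric_def intro: symI)
  ultimately have K: "pair_graph K"
    using sub irrefl by unfold_locales auto
  have "pullback_map G K e"
    unfolding pullback_map_def adj_eq_def using img arc eq_iff by (auto simp: K_def)
  hence "digraph_iso (with_proj G) (with_proj K)"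
    using digraph_iso_with_projI[OF pair_graph K] e by (simp add: K_def)
  with K show thesis by (rule that)
qed

theorem proposition2p6:
  fixes G :: "'a pair_pre_digraph" and H :: "'b pair_pre_digraph"
  assumes "pair_graph G" and "pair_graph H"
  shows "digraph_iso (with_proj (skeleton G)) (with_proj (skeleton H)) \<longleftrightarrow>
    (\<exists>(K :: 'k::infinite pair_pre_digraph) (F :: 'l::infinite pair_pre_digraph).
       pair_graph K \<and> pair_graph F \<and> digraph_iso (with_proj K) (with_proj F) \<and>
       full_pullback G K \<and> full_pullback H F)"
proof
  interpret G: pair_graph G by fact
  interpret H: pair_graph H by fact
  interpret SG: pair_graph "skeleton G" by (rule G.pair_graph_skeleton)
  interpret SH: pair_graph "skeleton H" by (rule H.pair_graph_skeleton)
  assume iso: "digraph_iso (with_proj (skeleton G)) (with_proj (skeleton H))"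
  \<comment> \<open>The natural witnesses are the two skeletons, but their vertices are sets of
    vertices; \<open>K\<close> and \<open>F\<close> are copies of them in the prescribed
    types.\<close>
  obtain K :: "'k pair_pre_digraph"
    where K: "pair_graph K" "digraph_iso (with_proj (skeleton G)) (with_proj K)"
    by (rule SG.iso_copy_in_infinite_type)
  obtain F :: "'l pair_pre_digraph"
    where F: "pair_graph F" "digraph_iso (with_proj (skeleton H)) (with_proj F)"
    by (rule SH.iso_copy_in_infinite_type)
  have "digraph_iso (with_proj K) (with_proj F)"
    using digraph_iso_swap[OF SG.wf_digraph K(2)] iso F(2) by (blast intro: digraph_iso_trans)
  moreover have "full_pullback G K"
    using G.full_pullback_skeleton K(2)
    by (blast intro: full_pullback_trans digraph_iso_imp_full_pullback)
  moreover have "full_pullback H F"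
    using H.full_pullback_skeleton F(2)
    by (blast intro: full_pullback_trans digraph_iso_imp_full_pullback)
  ultimately show "\<exists>(K :: 'k pair_pre_digraph) (F :: 'l pair_pre_digraph).
       pair_graph K \<and> pair_graph F \<and> digraph_iso (with_proj K) (with_proj F) \<and>
       full_pullback G K \<and> full_pullback H F"
    using K(1) F(1) by blast
next
  assume "\<exists>(K :: 'k pair_pre_digraph) (F :: 'l pair_pre_digraph).
       pair_graph K \<and> pair_graph F \<and> digraph_iso (with_proj K) (with_proj F) \<and>
       full_pullback G K \<and> full_pullback H F"
  then obtain K :: "'k pair_pre_digraph" and F :: "'l pair_pre_digraph"
    where KF: "pair_graph K" "pair_graph F" "digraph_iso (with_proj K) (with_proj F)"
      "full_pullback G K" "full_pullback H F"
    by blast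
  \<comment> \<open>Inverting an isomorphism with source \<open>skeleton H\<close>, as done below,
    requires this source to be well-formed.\<close>
  interpret SH: pair_graph "skeleton H" using assms(2) by (rule pair_graph.pair_graph_skeleton)
  \<comment> \<open>Following the pullback onto \<open>K\<close> by the isomorphism from
    \<open>K\<close> to \<open>F\<close> makes \<open>G\<close> and \<open>H\<close> full pullbacks
    of the same graph \<open>F\<close>, so both skeletons can be compared with
    \<open>skeleton F\<close>.\<close>
  have "full_pullback G F"
    using KF(3,4) by (blast intro: full_pullback_trans digraph_iso_imp_full_pullback)
  with assms(1) KF(2) have "digraph_iso (with_proj (skeleton G)) (with_proj (skeleton F))"
    by (rule full_pullback_imp_skeleton_iso)
  also have "digraph_iso (with_proj (skeleton F)) (with_proj (skeleton H))"
    using full_pullback_imp_skeleton_iso[OF assms(2) KF(2,5)]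
    by (rule digraph_iso_swap[OF SH.wf_digraph])
  finally show "digraph_iso (with_proj (skeleton G)) (with_proj (skeleton H))" .
qed

end
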